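(* Let $d=39028039587479$. Then $d$ is a prime number with $d\equiv 3 \pmod 4$, and if $\varepsilon>1$ denotes the fundamental unit of the ring of integers $\mathcal{O}_K=\mathbb{Z}[\sqrt{d}]$ of $K=\mathbb{Q}(\sqrt{d})$, written as $\varepsilon=x+y\sqrt{d}$ with $x,y\in\mathbb{N}_0$, then $d\mid y$. In other words, $d$ is a counterexample to Mordell's Pellian Equation Conjecture.
   Context: Mordell's Pellian Equation Conjecture asserts: if $d$ is a prime with $d\equiv 3\pmod 4$, $K=\mathbb{Q}(\sqrt{d})$, $\varepsilon>1$ is the fundamental unit of the ring of integers $\mathcal{O}_K=\mathbb{Z}[\sqrt{d}]$ (i.e. the smallest unit greater than $1$, generating $\mathcal{O}_K^{\times}$ modulo $\pm1$), and $\varepsilon=x+y\sqrt{d}$ with $x,y\in\mathbb{N}_0$, then $d\nmid y$. Here $\mathbb{N}_0$ denotes the set of nonnegative integers. *)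

theory Defs
  imports
    "HOL-Computational_Algebra.Computational_Algebra"
    "HOL-Number_Theory.Cong"
begin

text \<open>
  The real quadratic field \<open>K = \<rat>(\<surd>d)\<close> and its subrings are represented as sets of real numbers,
  using the embedding with \<open>\<surd>d > 0\<close>.
\<close>

definition quadratic_field :: "nat \<Rightarrow> real set" where
  "quadratic_field d = {a + b * sqrt (real d) | a b. a \<in> \<rat> \<and> b \<in> \<rat>}"

definition ring_of_integers :: "real set \<Rightarrow> real set" where
  "ring_of_integers K = {z \<in> K. algebraic_int z}"

definition adjoin_sqrt :: "nat \<Rightarrow> real set" where
  "adjoin_sqrt d = {a + b * sqrt (real d) | a b. a \<in> \<int> \<and> b \<in> \<int>}"

definition ring_units :: "real set \<Rightarrow> real set" where
  "ring_units R = {u \<in> R. \<exists>v\<in>R. u * v = 1}"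

definition is_fundamental_unit :: "real set \<Rightarrow> real \<Rightarrow> bool" where
  "is_fundamental_unit R \<epsilon> \<longleftrightarrow>
     \<epsilon> \<in> ring_units R \<and> \<epsilon> > 1 \<and>
     (\<forall>u\<in>ring_units R. u > 1 \<longrightarrow> \<epsilon> \<le> u) \<and>
     (\<forall>u\<in>ring_units R. \<exists>k::int. u = \<epsilon> powi k \<or> u = - (\<epsilon> powi k))"

text \<open>The assertion of Mordell's Pellian Equation Conjecture for a given \<open>d\<close>.\<close>

definition mordell_pellian_at :: "nat \<Rightarrow> bool" where
  "mordell_pellian_at d \<longleftrightarrow>
     (prime d \<and> [d = 3] (mod 4) \<longrightarrow>
       (\<forall>\<epsilon> (x::nat) (y::nat).
          is_fundamental_unit (ring_of_integers (quadratic_field d)) \<epsilon> \<and>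
          \<epsilon> = real x + real y * sqrt (real d) \<longrightarrow> \<not> d dvd y))"

end

theory Submission
  imports Defs "HOL-Number_Theory.Pocklington"
begin

text \<open>
  It suffices to exhibit one unit \<open>\<eta> = X + Y \<surd>d > 1\<close> with \<open>d\<close> dividing \<open>Y\<close> and \<open>\<eta> \<le> 2 ^ e\<close> for some
  \<open>e < d\<close>. Indeed \<open>\<eta> = \<epsilon> ^ n\<close> with \<open>0 < n \<le> e\<close>, because \<open>\<epsilon> \<ge> 2\<close>; and modulo \<open>d\<close> the second coordinate of
  \<open>(x + y \<surd>d) ^ n\<close> is \<open>n * x ^ (n - 1) * y\<close>, where neither \<open>n\<close> nor \<open>x\<close> is divisible by \<open>d\<close>.

  Such an \<open>\<eta>\<close> has about two million digits, so it is given by a compact representation: a chain of elements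
  \<open>\<theta>\<close> of small norm \<open>N\<close>, each obtained from the previous one as \<open>\<theta>\<^sup>2 * \<beta> / N\<^sup>2\<close> with a small \<open>\<beta>\<close>.
  Only \<open>N\<close>, the ideal generated by \<open>\<theta>\<close>, the residue of \<open>y / x\<close> modulo \<open>d\<close> and a bound on \<open>\<theta>\<close> have to be tracked.
  The witnesses come from the continued fraction expansion of \<open>\<surd>d\<close> (period length 3650856); here \<open>\<eta>\<close>
  is its fundamental solution, of logarithm about 4328927.7.
\<close>

section \<open>The ring of integers\<close>

text \<open>As an algebraic integer, a rational \<surd>d would be an integer, and the prime
  \<open>d\<close> would be a perfect square.\<close>

lemma sqrt_prime_irrational:
  fixes d :: nat
  assumes "prime d"
  shows "sqrt (real d) \<notin> \<rat>"
proof
  assume "sqrt (real d) \<in> \<rat>"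
  moreover have "algebraic_int (sqrt (real d))" by (intro algebraic_int_sqrt int_imp_algebraic_int) simp
  ultimately have "sqrt (real d) \<in> \<int>" by (rule rational_algebraic_int_is_int[rotated])
  then obtain k :: int where k: "sqrt (real d) = of_int k" by (rule Ints_cases)
  then have "real_of_int (int d) = real_of_int (k * k)"
    by (metis of_int_mult of_int_of_nat_eq of_nat_0_le_iff real_sqrt_mult_self abs_of_nonneg)
  then have "int d = k * k" by (simp only: of_int_eq_iff)
  then have "d = nat \<bar>k\<bar> * nat \<bar>k\<bar>"
    by (metis abs_mult_self_eq int_nat_eq nat_int nat_mult_distrib abs_ge_zero)
  then show False using assms
    by (metis prime_product mult_1 not_prime_1)
qed

lemma rational_sqrt_eq_iff:
  fixes d :: nat
  assumes "prime d" "a \<in> \<rat>" "b \<in> \<rat>" "a' \<in> \<rat>" "b' \<in> \<rat>"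
  shows "a + b * sqrt d = a' + b' * sqrt d \<longleftrightarrow> a = a' \<and> b = b'"
proof
  assume eq: "a + b * sqrt d = a' + b' * sqrt d"
  have "b = b'"
  proof (rule ccontr)
    assume "b \<noteq> b'"
    then have "sqrt d = (a' - a) / (b - b')" using eq by (simp add: field_simps)
    also have "\<dots> \<in> \<rat>" using assms by auto
    finally show False using sqrt_prime_irrational[OF assms(1)] by simp
  qed
  then show "a = a' \<and> b = b'" using eq by simp
qed auto

lemma of_int_sqrt_eq_iff:
  fixes d :: nat and a b a' b' :: int
  assumes "prime d"
  shows "of_int a + of_int b * sqrt d = of_int a' + of_int b' * sqrt d \<longleftrightarrow> a = a' \<and> b = b'"
  using rational_sqrt_eq_iff[OF assms, of "of_int a" "of_int b" "of_int a'" "of_int b'"] by simp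

lemma adjoin_sqrt_iff: "z \<in> adjoin_sqrt d \<longleftrightarrow> (\<exists>a b :: int. z = of_int a + of_int b * sqrt d)"
  unfolding adjoin_sqrt_def by (auto elim!: Ints_cases) (metis Ints_of_int)

lemma adjoin_sqrt_add:
  assumes "u \<in> adjoin_sqrt d" "v \<in> adjoin_sqrt d"
  shows "u + v \<in> adjoin_sqrt d"
proof -
  obtain a b a' b' :: int where "u = of_int a + of_int b * sqrt d" "v = of_int a' + of_int b' * sqrt d"
    using assms unfolding adjoin_sqrt_iff by blast
  then have "u + v = of_int (a + a') + of_int (b + b') * sqrt d" by (simp add: algebra_simps)
  then show ?thesis unfolding adjoin_sqrt_iff by blast
qed

lemma of_int_sqrt_mult:
  fixes a b a' b' :: int
  shows "(of_int a + of_int b * sqrt d) * (of_int a' + of_int b' * sqrt d) =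
    of_int (a * a' + int d * b * b') + of_int (a * b' + b * a') * sqrt d"
proof -
  have "real d = sqrt d * sqrt d" by simp
  then show ?thesis by (simp only: of_int_add of_int_mult of_int_of_nat_eq algebra_simps)
qed

lemma adjoin_sqrt_mult:
  assumes "u \<in> adjoin_sqrt d" "v \<in> adjoin_sqrt d"
  shows "u * v \<in> adjoin_sqrt d"
  using assms unfolding adjoin_sqrt_iff by (metis of_int_sqrt_mult)

lemma Ints_subset_adjoin_sqrt: "\<int> \<subseteq> adjoin_sqrt d"
proof
  fix z :: real assume "z \<in> \<int>"
  then obtain k :: int where "z = of_int k" by (rule Ints_cases)
  then have "z = of_int k + of_int 0 * sqrt d" by simp
  then show "z \<in> adjoin_sqrt d" unfolding adjoin_sqrt_iff by blast
qed

lemma adjoin_sqrt_sum: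
  assumes "\<And>i. i \<in> I \<Longrightarrow> f i \<in> adjoin_sqrt d"
  shows "sum f I \<in> adjoin_sqrt d"
  using assms by (induction I rule: infinite_finite_induct)
    (auto intro: adjoin_sqrt_add subsetD[OF Ints_subset_adjoin_sqrt])

lemma adjoin_sqrt_power: "u \<in> adjoin_sqrt d \<Longrightarrow> u ^ n \<in> adjoin_sqrt d"
  by (induction n) (auto intro: adjoin_sqrt_mult subsetD[OF Ints_subset_adjoin_sqrt])

text \<open>Uniqueness of coordinates removes the \<surd>d part. This turns membership in
  \<int>[\<surd>d] into integrality for rational quantities such as traces and norms.\<close>

lemma adjoin_sqrt_rational_is_int:
  assumes "prime d" "z \<in> adjoin_sqrt d" "z \<in> \<rat>"
  shows "z \<in> \<int>"
proof -
  obtain a b :: int where z: "z = of_int a + of_int b * sqrt d"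
    using assms(2) unfolding adjoin_sqrt_iff by blast
  then have "z + 0 * sqrt d = of_int a + of_int b * sqrt d" by simp
  then have "z = of_int a"
    using rational_sqrt_eq_iff[OF assms(1,3), of 0 "of_int a" "of_int b"] by simp
  then show ?thesis by simp
qed

text \<open>
  Integrality of trace and norm: all powers of an algebraic integer of \<open>\<rat>(\<surd>d)\<close> have a common denominator,
  hence so do all powers of its trace and norm.
\<close>

lemma rational_with_bounded_denominators_is_int:
  fixes q :: real and D :: int
  assumes "q \<in> \<rat>" "D \<noteq> 0" "\<And>n :: nat. of_int D * q ^ n \<in> \<int>"
  shows "q \<in> \<int>"
proof -
  obtain a b :: int where ab: "b > 0" "coprime a b" "q = of_int a / of_int b"
    using assms(1) by (metis Rats_cases')
  have dvd: "b ^ n dvd D" for n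
  proof -
    obtain m :: int where "of_int D * q ^ n = of_int m" using assms(3)[of n] by (auto elim: Ints_cases)
    then have "real_of_int (D * a ^ n) = of_int (m * b ^ n)"
      using ab(1) unfolding ab(3) by (simp add: field_simps power_divide)
    then have "D * a ^ n = m * b ^ n" by (simp only: of_int_eq_iff)
    then have "b ^ n dvd D * a ^ n" by simp
    moreover have "coprime (b ^ n) (a ^ n)" using ab(2) by (simp add: coprime_commute)
    ultimately show ?thesis by (simp add: coprime_dvd_mult_left_iff)
  qed
  have "b = 1"
  proof (rule ccontr)
    assume "b \<noteq> 1"
    then have "2 \<le> b" using ab(1) by simp
    \<comment> \<open>Every \<open>b ^ n\<close> divides the nonzero \<open>D\<close>, but for this
      \<open>n\<close> already \<open>2 ^ n\<close> exceeds \<bar>D\<bar>.\<close>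
    define n where "n = nat \<bar>D\<bar>"
    have "\<bar>D\<bar> < 2 ^ n" unfolding n_def
      by (metis int_nat_eq abs_ge_zero of_nat_less_iff less_exp of_nat_numeral of_nat_power)
    also have "\<dots> \<le> b ^ n" using \<open>2 \<le> b\<close> by (intro power_mono) auto
    also have "\<dots> \<le> \<bar>D\<bar>" using dvd[of n] assms(2) by (intro zdvd_imp_le) auto
    finally show False by simp
  qed
  then show ?thesis using ab(3) by simp
qed

text \<open>If \<open>E\<close> clears the denominators of \<open>z\<close> and \<open>m\<close> is
  the degree of a monic integer polynomial with root \<open>z\<close>, then \<open>E ^ m\<close>
  clears every power: directly for exponents below \<open>m\<close>, and beyond that because the
  monic equation writes \<open>z ^ n\<close> as an integer combination of lower powers.\<close>

lemma algebraic_int_powers_bounded_denominators: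
  fixes z a b :: real
  assumes "algebraic_int z" "z = a + b * sqrt d" "a \<in> \<rat>" "b \<in> \<rat>"
  obtains D :: int where "D \<noteq> 0" "\<And>n. of_int D * z ^ n \<in> adjoin_sqrt d"
proof -
  obtain p :: "real poly" where p: "Polynomial.lead_coeff p = 1" "\<forall>i. Polynomial.coeff p i \<in> \<int>" "poly p z = 0"
    using assms(1) by (auto elim: algebraic_int.cases)
  define m where "m = Polynomial.degree p"
  obtain a1 a2 :: int where a: "a2 > 0" "a = of_int a1 / of_int a2" using assms(3) by (metis Rats_cases')
  obtain b1 b2 :: int where b: "b2 > 0" "b = of_int b1 / of_int b2" using assms(4) by (metis Rats_cases')
  define E where "E = a2 * b2"
  have E0: "E \<noteq> 0" using a(1) b(1) by (simp add: E_def)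
  have "of_int E * z = of_int (a1 * b2) + of_int (b1 * a2) * sqrt d"
    using a(1) b(1) unfolding assms(2) a(2) b(2) E_def by (simp add: field_simps)
  then have Ez: "of_int E * z \<in> adjoin_sqrt d" unfolding adjoin_sqrt_iff by blast
  have "of_int (E ^ m) * z ^ n \<in> adjoin_sqrt d" for n
  proof (induction n rule: less_induct)
    case (less n)
    show ?case
    proof (cases "n < m")
      case True
      then have "of_int (E ^ m) * z ^ n = of_int (E ^ (m - n)) * (of_int E * z) ^ n"
        by (simp add: power_mult_distrib power_add[symmetric] flip: mult.assoc)
      also have "\<dots> \<in> adjoin_sqrt d"
        by (intro adjoin_sqrt_mult adjoin_sqrt_power Ez subsetD[OF Ints_subset_adjoin_sqrt]) simp
      finally show ?thesis .
    next
      case False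
      have "0 = (\<Sum>i<Suc m. Polynomial.coeff p i * z ^ i)"
        using p(3) by (simp add: poly_altdef m_def lessThan_Suc_atMost)
      then have "z ^ m = - (\<Sum>i<m. Polynomial.coeff p i * z ^ i)"
        using p(1) by (simp add: m_def)
      then have "z ^ n = - (\<Sum>i<m. Polynomial.coeff p i * z ^ i) * z ^ (n - m)"
        using False by (metis le_add_diff_inverse not_less power_add)
      also have "of_int (E ^ m) * \<dots> = (\<Sum>i<m. - Polynomial.coeff p i * (of_int (E ^ m) * z ^ (i + (n - m))))"
        by (simp add: sum_distrib_left sum_distrib_right sum_negf power_add mult_ac)
      also have "\<dots> \<in> adjoin_sqrt d"
      proof (rule adjoin_sqrt_sum)
        fix i assume "i \<in> {..<m}"
        then have "i + (n - m) < n" using False by simp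
        then show "- Polynomial.coeff p i * (of_int (E ^ m) * z ^ (i + (n - m))) \<in> adjoin_sqrt d"
          using p(2) by (intro adjoin_sqrt_mult less.IH subsetD[OF Ints_subset_adjoin_sqrt]) auto
      qed
      finally show ?thesis .
    qed
  qed
  then show ?thesis using that[of "E ^ m"] E0 by auto
qed

text \<open>Conjugation commutes with rational polynomials. Stating this with shared coordinates
  \<open>u\<close>, \<open>v\<close> avoids introducing conjugation as a map on real
  numbers.\<close>

lemma poly_rational_conjugate:
  fixes p :: "real poly" and a b :: real and d :: nat
  assumes "\<forall>i. Polynomial.coeff p i \<in> \<rat>" "a \<in> \<rat>" "b \<in> \<rat>"
  shows "\<exists>u\<in>\<rat>. \<exists>v\<in>\<rat>. poly p (a + b * sqrt d) = u + v * sqrt d \<and> poly p (a - b * sqrt d) = u - v * sqrt d"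
  using assms(1)
proof (induction p)
  case 0
  show ?case by (intro bexI[of _ 0]) auto
next
  case (pCons c p)
  have c: "c \<in> \<rat>" using pCons.prems by (metis coeff_pCons_0)
  have "\<forall>i. Polynomial.coeff p i \<in> \<rat>" using pCons.prems by (metis coeff_pCons_Suc)
  then obtain u v where uv: "u \<in> \<rat>" "v \<in> \<rat>" "poly p (a + b * sqrt d) = u + v * sqrt d"
      "poly p (a - b * sqrt d) = u - v * sqrt d"
    using pCons.IH by blast
  have "poly (pCons c p) (a + b * sqrt d) = (c + a * u + (sqrt d * sqrt d) * b * v) + (a * v + b * u) * sqrt d"
    unfolding poly_pCons uv(3) by (simp only: algebra_simps)
  moreover have "poly (pCons c p) (a - b * sqrt d) = (c + a * u + (sqrt d * sqrt d) * b * v) - (a * v + b * u) * sqrt d"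
    unfolding poly_pCons uv(4) by (simp only: algebra_simps)
  moreover have "c + a * u + (sqrt d * sqrt d) * b * v \<in> \<rat>" "a * v + b * u \<in> \<rat>"
    using c uv assms(2,3) by auto
  ultimately show ?case by blast
qed

text \<open>The conjugate is a root of the same monic polynomial: the value at the given number has
  both coordinates zero, hence so has the value at the conjugate.\<close>

lemma algebraic_int_quadratic_conjugate:
  assumes "prime d" "algebraic_int (a + b * sqrt d)" "a \<in> \<rat>" "b \<in> \<rat>"
  shows "algebraic_int (a - b * sqrt (real d))"
proof -
  obtain p :: "real poly" where p: "Polynomial.lead_coeff p = 1" "\<forall>i. Polynomial.coeff p i \<in> \<int>" "poly p (a + b * sqrt d) = 0"
    using assms(2) by (auto elim: algebraic_int.cases)
  have "\<forall>i. Polynomial.coeff p i \<in> \<rat>" using p(2) Ints_subset_Rats by blast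
  from poly_rational_conjugate[OF this assms(3,4)] obtain u v
    where uv: "u \<in> \<rat>" "v \<in> \<rat>" "poly p (a + b * sqrt d) = u + v * sqrt d"
      "poly p (a - b * sqrt d) = u - v * sqrt d" by blast
  then have "u = 0 \<and> v = 0"
    using p(3) rational_sqrt_eq_iff[OF assms(1) uv(1,2), of 0 0] by simp
  then show ?thesis using p uv(4) by (intro algebraic_int.intros[of p]) auto
qed

text \<open>The product \<open>D * D'\<close> of the denominators for \<open>z\<close> and its
  conjugate clears all mixed products \<open>z ^ i * z' ^ j\<close>. Powers of the norm are such
  products, and powers of the trace are integer combinations of them by the binomial
  theorem.\<close>

lemma algebraic_int_trace_norm:
  assumes "prime d" "algebraic_int (a + b * sqrt (real d))" "a \<in> \<rat>" "b \<in> \<rat>"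
  shows "2 * a \<in> \<int>" "a\<^sup>2 - real d * b\<^sup>2 \<in> \<int>"
proof -
  define z z' where "z = a + b * sqrt d" and "z' = a - b * sqrt d"
  have z': "z' = a + (- b) * sqrt d" by (simp add: z'_def)
  have "algebraic_int z" "algebraic_int z'"
    using assms algebraic_int_quadratic_conjugate[OF assms] by (simp_all add: z_def z'_def)
  obtain D where D: "D \<noteq> 0" "\<And>n. of_int D * z ^ n \<in> adjoin_sqrt d"
    using algebraic_int_powers_bounded_denominators[OF \<open>algebraic_int z\<close> z_def assms(3,4)] by blast
  have "- b \<in> \<rat>" using assms(4) by simp
  obtain D' where D': "D' \<noteq> 0" "\<And>n. of_int D' * z' ^ n \<in> adjoin_sqrt d"
    using algebraic_int_powers_bounded_denominators[OF \<open>algebraic_int z'\<close> z' assms(3) \<open>- b \<in> \<rat>\<close>] by blast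
  have prod: "of_int (D * D') * (z ^ i * z' ^ j) \<in> adjoin_sqrt d" for i j
    using adjoin_sqrt_mult[OF D(2)[of i] D'(2)[of j]] by (simp add: mult_ac)
  have sum: "z + z' = 2 * a" by (simp add: z_def z'_def)
  show "2 * a \<in> \<int>"
  proof (rule rational_with_bounded_denominators_is_int)
    show "2 * a \<in> \<rat>" "D * D' \<noteq> 0" using assms D D' by simp_all
    fix n
    have "of_int (D * D') * (2 * a) ^ n
        = (\<Sum>k\<le>n. of_nat (n choose k) * (of_int (D * D') * (z ^ k * z' ^ (n - k))))"
      unfolding sum[symmetric] binomial_ring by (simp add: sum_distrib_left mult_ac)
    also have "\<dots> \<in> adjoin_sqrt d"
      by (intro adjoin_sqrt_sum adjoin_sqrt_mult prod subsetD[OF Ints_subset_adjoin_sqrt]) simp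
    finally show "of_int (D * D') * (2 * a) ^ n \<in> \<int>"
      using assms by (intro adjoin_sqrt_rational_is_int) auto
  qed
  have norm: "z * z' = a\<^sup>2 - real d * b\<^sup>2"
    by (simp add: z_def z'_def algebra_simps power2_eq_square)
  show "a\<^sup>2 - real d * b\<^sup>2 \<in> \<int>"
  proof (rule rational_with_bounded_denominators_is_int)
    show rat: "a\<^sup>2 - real d * b\<^sup>2 \<in> \<rat>" and "D * D' \<noteq> 0" using assms D D' by simp_all
    fix n
    have "of_int (D * D') * (a\<^sup>2 - real d * b\<^sup>2) ^ n \<in> adjoin_sqrt d"
      using prod[of n n] by (simp add: norm[symmetric] power_mult_distrib)
    then show "of_int (D * D') * (a\<^sup>2 - real d * b\<^sup>2) ^ n \<in> \<int>"
      using assms(1) rat by (intro adjoin_sqrt_rational_is_int) auto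
  qed
qed

section \<open>The ring of integers for \<open>d\<close> congruent to 3 modulo 4\<close>

lemma square_mod_4_int: "(x :: int)\<^sup>2 mod 4 = (if even x then 0 else 1)"
proof (cases "even x")
  case True
  then obtain k where "x = 2 * k" by (rule evenE)
  then show ?thesis using True by (simp add: power_mult_distrib)
next
  case False
  then obtain k where "x = 2 * k + 1" by (rule oddE)
  then have "x\<^sup>2 = 1 + 4 * (k * k + k)" by (simp add: power2_eq_square algebra_simps)
  then show ?thesis using False by (simp only: mod_mult_self2) simp
qed

text \<open>Elements of \<int>[\<surd>d] are roots of explicit monic quadratics. Conversely,
  integrality of trace and norm leaves only half-integral coordinates, and the residue of
  \<open>d\<close> modulo 4 excludes the proper halves.\<close>

lemma ring_of_integers_quadratic_field:
  assumes "prime d" "[d = 3] (mod 4)"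
  shows "ring_of_integers (quadratic_field d) = adjoin_sqrt d"
proof (intro Set.set_eqI iffI)
  fix z assume "z \<in> adjoin_sqrt d"
  then obtain a b :: int where z: "z = of_int a + of_int b * sqrt d" unfolding adjoin_sqrt_iff by blast
  let ?p = "[: of_int (a\<^sup>2 - int d * b\<^sup>2), of_int (- 2 * a), 1 :] :: real poly"
  have "algebraic_int z"
  proof (rule algebraic_int.intros)
    show "Polynomial.lead_coeff ?p = 1" by simp
    show "\<forall>i. Polynomial.coeff ?p i \<in> \<int>" by (auto simp: coeff_pCons split: nat.splits)
    show "poly ?p z = 0" unfolding z by (simp add: algebra_simps power2_eq_square)
  qed
  then show "z \<in> ring_of_integers (quadratic_field d)"
    unfolding ring_of_integers_def quadratic_field_def z by force
next
  fix z assume "z \<in> ring_of_integers (quadratic_field d)"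
  then obtain a b where z: "z = a + b * sqrt d" "a \<in> \<rat>" "b \<in> \<rat>" "algebraic_int z"
    unfolding ring_of_integers_def quadratic_field_def by blast
  note int = algebraic_int_trace_norm[OF assms(1) z(4)[unfolded z(1)] z(2,3)]
  obtain A :: int where A: "2 * a = of_int A" using int(1) by (rule Ints_cases)
  obtain N :: int where N: "a\<^sup>2 - real d * b\<^sup>2 = of_int N" using int(2) by (rule Ints_cases)
  have dB: "real d * (2 * b)\<^sup>2 = of_int (A\<^sup>2 - 4 * N)"
    using A N by (simp add: power_mult_distrib flip: A N)
  obtain p q :: int where pq: "q > 0" "coprime p q" "2 * b = of_int p / of_int q"
    using z(3) by (metis Rats_cases' Rats_mult Rats_number_of)
  have "real_of_int (int d * p\<^sup>2) = of_int ((A\<^sup>2 - 4 * N) * q\<^sup>2)"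
    using dB pq(1) unfolding pq(3) by (simp add: field_simps power_divide)
  then have "int d * p\<^sup>2 = (A\<^sup>2 - 4 * N) * q\<^sup>2" by (simp only: of_int_eq_iff)
  \<comment> \<open>Since \<open>q\<close> is coprime to \<open>p\<close>, its square must divide
    the squarefree number \<open>d\<close>, so \<open>2 * b\<close> has no denominator.\<close>
  then have "q\<^sup>2 dvd int d * p\<^sup>2" by simp
  moreover have "coprime (q\<^sup>2) (p\<^sup>2)" using pq(2) by (simp add: coprime_commute)
  ultimately have "q\<^sup>2 dvd int d" by (simp add: coprime_dvd_mult_left_iff)
  moreover have "squarefree (int d)" using assms(1) by (intro squarefree_prime) simp
  ultimately have "is_unit q" by (auto simp: squarefree_def)
  then have "2 * b = of_int p" using pq(1,3) by simp
  have "real_of_int (int d * p\<^sup>2) = of_int (A\<^sup>2 - 4 * N)"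
    using dB unfolding \<open>2 * b = of_int p\<close> by simp
  then have "int d * p\<^sup>2 = A\<^sup>2 - 4 * N" by (simp only: of_int_eq_iff)
  \<comment> \<open>Modulo 4 this reads \<open>A\<^sup>2 = 3 * p\<^sup>2\<close>. Squares are 0 or 1
    there, so both sides must vanish and both halves are integers.\<close>
  then have "A\<^sup>2 mod 4 = (int d * p\<^sup>2 + 4 * N) mod 4" by simp
  also have "\<dots> = ((int d mod 4) * (p\<^sup>2 mod 4)) mod 4" by (simp add: mod_mult_eq)
  also have "int d mod 4 = 3" using assms(2) unfolding cong_def by (simp flip: of_nat_mod zmod_int) presburger
  finally have "even A \<and> even p" unfolding square_mod_4_int by (simp split: if_splits)
  then obtain A' p' where "A = 2 * A'" "p = 2 * p'" by (auto elim!: evenE)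
  then have "a = of_int A'" "b = of_int p'" using A \<open>2 * b = of_int p\<close> by simp_all
  then show "z \<in> adjoin_sqrt d" unfolding adjoin_sqrt_iff z(1) by blast
qed

section \<open>Units\<close>

text \<open>The norm is multiplicative, so units have norm 1 or -1. Conversely, an element of norm
  \<open>s\<close> with \<open>s * s = 1\<close> is inverted by \<open>s\<close> times its
  conjugate.\<close>

lemma ring_units_adjoin_sqrt_iff:
  assumes "prime d"
  shows "u \<in> ring_units (adjoin_sqrt d) \<longleftrightarrow>
    (\<exists>a b :: int. u = of_int a + of_int b * sqrt d \<and> \<bar>a\<^sup>2 - int d * b\<^sup>2\<bar> = 1)"
proof
  assume "u \<in> ring_units (adjoin_sqrt d)"
  then obtain v where uv: "u \<in> adjoin_sqrt d" "v \<in> adjoin_sqrt d" "u * v = 1"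
    unfolding ring_units_def by blast
  then obtain a b a' b' :: int where ab: "u = of_int a + of_int b * sqrt d" "v = of_int a' + of_int b' * sqrt d"
    unfolding adjoin_sqrt_iff by blast
  have "of_int (a * a' + int d * b * b') + of_int (a * b' + b * a') * sqrt d = of_int 1 + of_int 0 * sqrt d"
    using uv(3) unfolding ab of_int_sqrt_mult by simp
  then have 1: "a * a' + int d * b * b' = 1" "a * b' + b * a' = 0"
    unfolding of_int_sqrt_eq_iff[OF assms] by simp_all
  have "(a\<^sup>2 - int d * b\<^sup>2) * (a'\<^sup>2 - int d * b'\<^sup>2) = (a * a' + int d * b * b')\<^sup>2 - int d * (a * b' + b * a')\<^sup>2"
    by (simp add: power2_eq_square algebra_simps)
  also have "\<dots> = 1" unfolding 1 by simp
  finally have "\<bar>a\<^sup>2 - int d * b\<^sup>2\<bar> = 1" by (auto simp: zmult_eq_1_iff)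
  then show "\<exists>a b :: int. u = of_int a + of_int b * sqrt d \<and> \<bar>a\<^sup>2 - int d * b\<^sup>2\<bar> = 1"
    using ab(1) by blast
next
  assume "\<exists>a b :: int. u = of_int a + of_int b * sqrt d \<and> \<bar>a\<^sup>2 - int d * b\<^sup>2\<bar> = 1"
  then obtain a b :: int where ab: "u = of_int a + of_int b * sqrt d" "\<bar>a\<^sup>2 - int d * b\<^sup>2\<bar> = 1" by blast
  define s where "s = a\<^sup>2 - int d * b\<^sup>2"
  have "s * s = 1" using ab(2) unfolding s_def by (metis abs_mult_self_eq mult_1)
  have "u * (of_int (s * a) + of_int (- s * b) * sqrt d) = of_int (s * s) + of_int 0 * sqrt d"
    unfolding ab(1) of_int_sqrt_mult of_int_sqrt_eq_iff[OF assms]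
    by (simp add: s_def power2_eq_square algebra_simps)
  then have "u * (of_int (s * a) + of_int (- s * b) * sqrt d) = 1" unfolding \<open>s * s = 1\<close> by simp
  moreover have "of_int (s * a) + of_int (- s * b) * sqrt d \<in> adjoin_sqrt d" "u \<in> adjoin_sqrt d"
    using ab(1) unfolding adjoin_sqrt_iff by blast+
  ultimately show "u \<in> ring_units (adjoin_sqrt d)"
    unfolding ring_units_def by blast
qed

lemma ring_units_adjoin_sqrt_mult:
  assumes "u \<in> ring_units (adjoin_sqrt d)" "v \<in> ring_units (adjoin_sqrt d)"
  shows "u * v \<in> ring_units (adjoin_sqrt d)"
proof -
  obtain u' v' where "u' \<in> adjoin_sqrt d" "v' \<in> adjoin_sqrt d" "u * u' = 1" "v * v' = 1"
    using assms unfolding ring_units_def by blast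
  moreover from this have "(u * v) * (u' * v') = 1" by (metis mult.assoc mult.commute mult_1)
  ultimately show ?thesis
    using assms adjoin_sqrt_mult[of _ d] unfolding ring_units_def by blast
qed

lemma ring_units_inverse:
  fixes R :: "real set"
  assumes "u \<in> ring_units R"
  shows "inverse u \<in> ring_units R"
proof -
  obtain v where v: "u \<in> R" "v \<in> R" "u * v = 1" using assms unfolding ring_units_def by blast
  then have "inverse u = v" "v * u = 1" by (simp_all add: inverse_unique mult.commute)
  then show ?thesis using v unfolding ring_units_def by blast
qed

lemma ring_units_adjoin_sqrt_power_int:
  assumes "u \<in> ring_units (adjoin_sqrt d)"
  shows "u powi k \<in> ring_units (adjoin_sqrt d)"
proof -
  have one: "1 \<in> ring_units (adjoin_sqrt d)"
    using subsetD[OF Ints_subset_adjoin_sqrt Ints_1] unfolding ring_units_def by auto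
  have "v ^ n \<in> ring_units (adjoin_sqrt d)" if "v \<in> ring_units (adjoin_sqrt d)" for v n
    by (induction n) (use one that in \<open>auto intro: ring_units_adjoin_sqrt_mult\<close>)
  then show ?thesis
    using assms ring_units_inverse[OF assms] unfolding power_int_def by simp
qed

lemma ring_units_adjoin_sqrt_abs:
  assumes "prime d" "u \<in> ring_units (adjoin_sqrt d)"
  shows "\<bar>u\<bar> \<in> ring_units (adjoin_sqrt d)"
proof -
  obtain a b :: int where ab: "u = of_int a + of_int b * sqrt d" "\<bar>a\<^sup>2 - int d * b\<^sup>2\<bar> = 1"
    using assms unfolding ring_units_adjoin_sqrt_iff[OF assms(1)] by blast
  then have "- u = of_int (- a) + of_int (- b) * sqrt d" "\<bar>(- a)\<^sup>2 - int d * (- b)\<^sup>2\<bar> = 1" by simp_all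
  then have "- u \<in> ring_units (adjoin_sqrt d)" unfolding ring_units_adjoin_sqrt_iff[OF assms(1)] by blast
  then show ?thesis using assms(2) by (simp add: abs_real_def)
qed

text \<open>The conjugate \<open>w\<close> of \<open>u\<close> has absolute value
  \<open>1 / u\<close>, which is below 1. Hence \<open>u + w\<close> and \<open>u - w\<close>, which
  are twice the rational part and twice the irrational part, are both positive.\<close>

lemma ring_units_adjoin_sqrt_gt_1:
  assumes "prime d" "u \<in> ring_units (adjoin_sqrt d)" "1 < u"
  obtains a b :: int where "u = of_int a + of_int b * sqrt d" "\<bar>a\<^sup>2 - int d * b\<^sup>2\<bar> = 1" "0 < a" "0 < b"
proof -
  obtain a b :: int where ab: "u = of_int a + of_int b * sqrt d" "\<bar>a\<^sup>2 - int d * b\<^sup>2\<bar> = 1"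
    using assms unfolding ring_units_adjoin_sqrt_iff[OF assms(1)] by blast
  define w where "w = of_int a - of_int b * sqrt d"
  have "u * w = of_int (a\<^sup>2 - int d * b\<^sup>2)"
    unfolding ab(1) w_def by (simp add: power2_eq_square algebra_simps)
  then have "\<bar>u * w\<bar> = 1" using ab(2) by (metis of_int_1 of_int_abs)
  then have "u * \<bar>w\<bar> = 1" using assms(3) by (simp add: abs_mult)
  then have "\<bar>w\<bar> = 1 / u" using assms(3) by (simp add: field_simps)
  then have "\<bar>w\<bar> < 1" using assms(3) by simp
  have "0 < u + w" "0 < u - w" using \<open>\<bar>w\<bar> < 1\<close> assms(3) by auto
  then have "0 < a" "0 < real_of_int b * sqrt d" unfolding ab(1) w_def by simp_all
  then have "0 < a" "0 < b" using assms(1) by (simp_all add: zero_less_mult_iff)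
  then show ?thesis using ab that by blast
qed

text \<open>Units in the interval from 1 to \<eta> have positive coordinates bounded by \<eta>, so
  there are finitely many and a least one exists. Any other unit, up to sign, is divided by the
  largest power of it that does not exceed it; minimality makes the quotient 1.\<close>

lemma fundamental_unit_exists:
  assumes "prime d" "\<eta> \<in> ring_units (adjoin_sqrt d)" "1 < \<eta>"
  shows "\<exists>\<epsilon>. is_fundamental_unit (adjoin_sqrt d) \<epsilon>"
proof -
  let ?U = "ring_units (adjoin_sqrt d)"
  define S where "S = {u \<in> ?U. 1 < u \<and> u \<le> \<eta>}"
  have d1: "1 \<le> sqrt d" using prime_ge_1_nat[OF assms(1)] by simp
  have "S \<subseteq> (\<lambda>(a, b). of_int a + of_int b * sqrt d) ` ({0..\<lfloor>\<eta>\<rfloor>} \<times> {0..\<lfloor>\<eta>\<rfloor>})"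
  proof
    fix u assume "u \<in> S"
    then have u: "u \<in> ?U" "1 < u" "u \<le> \<eta>" by (simp_all add: S_def)
    obtain a b :: int where ab: "u = of_int a + of_int b * sqrt d" "0 < a" "0 < b"
      using ring_units_adjoin_sqrt_gt_1[OF assms(1) u(1,2)] by blast
    have "of_int b * 1 \<le> of_int b * sqrt d" using ab(3) d1 by (intro mult_left_mono) auto
    moreover have "0 < real_of_int a" "0 < real_of_int b" using ab by simp_all
    ultimately have "of_int a \<le> \<eta>" "of_int b \<le> \<eta>" using ab(1) u(3) by linarith+
    then have "(a, b) \<in> {0..\<lfloor>\<eta>\<rfloor>} \<times> {0..\<lfloor>\<eta>\<rfloor>}" using ab by (simp add: le_floor_iff)
    then show "u \<in> (\<lambda>(a, b). of_int a + of_int b * sqrt d) ` ({0..\<lfloor>\<eta>\<rfloor>} \<times> {0..\<lfloor>\<eta>\<rfloor>})"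
      using ab(1) by (intro image_eqI[of _ _ "(a, b)"]) simp_all
  qed
  then have "finite S" by (rule finite_subset) simp
  moreover have "\<eta> \<in> S" using assms by (simp add: S_def)
  ultimately have "Min S \<in> S" by (metis Min_in empty_iff)
  define \<epsilon> where "\<epsilon> = Min S"
  have \<epsilon>: "\<epsilon> \<in> ?U" "1 < \<epsilon>" "\<epsilon> \<le> \<eta>" using \<open>Min S \<in> S\<close> by (simp_all add: \<epsilon>_def S_def)
  have min: "\<epsilon> \<le> u" if "u \<in> ?U" "1 < u" for u
  proof (cases "u \<le> \<eta>")
    case True
    then show ?thesis using that \<open>finite S\<close> by (simp add: \<epsilon>_def S_def)
  qed (use \<epsilon>(3) in simp)
  have "\<exists>k::int. u = \<epsilon> powi k \<or> u = - (\<epsilon> powi k)" if u: "u \<in> ?U" for u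
  proof -
    have "u \<noteq> 0" using u by (auto simp: ring_units_def)
    \<comment> \<open>This \<open>k\<close> places \<bar>u\<bar> between two consecutive powers of
      \<epsilon>, so the quotient \<open>t\<close> below lies in [1, \<epsilon>).\<close>
    define k where "k = \<lfloor>log \<epsilon> \<bar>u\<bar>\<rfloor>"
    have pow: "\<epsilon> powi m = \<epsilon> powr of_int m" for m :: int
      using \<epsilon>(2) by (simp add: powr_real_of_int')
    have "of_int k \<le> log \<epsilon> \<bar>u\<bar>" "log \<epsilon> \<bar>u\<bar> < of_int (k + 1)" unfolding k_def by linarith+
    then have k: "\<epsilon> powi k \<le> \<bar>u\<bar>" "\<bar>u\<bar> < \<epsilon> powi (k + 1)"
      unfolding pow using \<epsilon>(2) \<open>u \<noteq> 0\<close>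
      by (simp_all only: le_log_iff[of \<epsilon> "\<bar>u\<bar>"] log_less_iff[of \<epsilon> "\<bar>u\<bar>"] zero_less_abs_iff not_False_eq_True)
    have pos: "0 < \<epsilon> powi k" using \<epsilon>(2) by simp
    define t where "t = \<bar>u\<bar> * inverse (\<epsilon> powi k)"
    have t: "t \<in> ?U" unfolding t_def
      by (intro ring_units_adjoin_sqrt_mult ring_units_adjoin_sqrt_abs assms(1) u
          ring_units_inverse ring_units_adjoin_sqrt_power_int \<epsilon>(1))
    have "1 \<le> t" using k(1) pos by (simp add: t_def field_simps)
    moreover have "t < \<epsilon>" using k(2) pos \<epsilon>(2) by (simp add: t_def field_simps power_int_add)
    ultimately have "t = 1" using min[OF t] by force
    then have "\<bar>u\<bar> = \<epsilon> powi k" using pos by (simp add: t_def field_simps)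
    then show ?thesis by (metis abs_real_def minus_minus)
  qed
  then have "is_fundamental_unit (adjoin_sqrt d) \<epsilon>"
    unfolding is_fundamental_unit_def using \<epsilon> min by blast
  then show ?thesis by blast
qed

text \<open>Modulo \<open>d\<close> the square of \<surd>d vanishes, so only the first two binomial
  terms survive. The congruence for \<open>Y\<close> is multiplied by \<open>x\<close>, which avoids
  the exponent \<open>n - 1\<close> and covers \<open>n = 0\<close>.\<close>

lemma power_of_int_sqrt_cong:
  fixes x y :: int and d n :: nat
  obtains X Y :: int where "(of_int x + of_int y * sqrt d) ^ n = of_int X + of_int Y * sqrt d"
    "int d dvd X - x ^ n" "int d dvd x * Y - int n * x ^ n * y"
proof -
  have "\<exists>X Y :: int. (of_int x + of_int y * sqrt d) ^ n = of_int X + of_int Y * sqrt d \<and>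
      int d dvd X - x ^ n \<and> int d dvd x * Y - int n * x ^ n * y"
  proof (induction n)
    case 0
    show ?case by (intro exI[of _ 1] exI[of _ 0]) simp
  next
    case (Suc n)
    then obtain X Y :: int where XY: "(of_int x + of_int y * sqrt d) ^ n = of_int X + of_int Y * sqrt d"
      "int d dvd X - x ^ n" "int d dvd x * Y - int n * x ^ n * y" by blast
    have X': "(x * X + int d * y * Y) - x ^ Suc n = x * (X - x ^ n) + int d * (y * Y)"
      by (simp add: algebra_simps)
    have Y': "x * (x * Y + y * X) - int (Suc n) * x ^ Suc n * y =
        x * (x * Y - int n * x ^ n * y) + x * y * (X - x ^ n)"
      by (simp add: algebra_simps)
    have "(of_int x + of_int y * sqrt d) ^ Suc n = of_int (x * X + int d * y * Y) + of_int (x * Y + y * X) * sqrt d"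
      unfolding power_Suc XY(1) of_int_sqrt_mult ..
    moreover have "int d dvd (x * X + int d * y * Y) - x ^ Suc n"
      unfolding X' by (rule dvd_add[OF dvd_mult[OF XY(2)] dvd_triv_left])
    moreover have "int d dvd x * (x * Y + y * X) - int (Suc n) * x ^ Suc n * y"
      unfolding Y' by (rule dvd_add[OF dvd_mult[OF XY(3)] dvd_mult[OF XY(2)]])
    ultimately show ?case by blast
  qed
  then show ?thesis using that by blast
qed

section \<open>Primality\<close>

text \<open>Trial division up to the square root; the explicit list lets the simplifier enumerate
  the candidates.\<close>

lemma prime_nat_sqrtI:
  fixes n m :: nat
  assumes "1 < n" "n < m * m" "\<forall>k\<in>set [2..<m]. \<not> k dvd n"
  shows "prime n"
proof -
  have "k = 1" if k: "k dvd n" "k\<^sup>2 \<le> n" for k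
  proof -
    have "k * k < m * m" using k(2) assms(2) by (simp add: power2_eq_square)
    then have "k < m" by (meson mult_le_mono not_le)
    moreover have "k \<noteq> 0" using k(1) assms(1) by (intro notI) simp
    ultimately show "k = 1" using assms(3) k(1) by (cases "k < 2") auto
  qed
  then show ?thesis using assms(1) by (auto simp: prime_divisor_sqrt)
qed

text \<open>A Bezout identity with the negative term moved to the right, so that checking it takes
  only products of natural numbers.\<close>

lemma coprime_nat_bezoutI:
  fixes a n u v :: nat
  assumes "a * u = 1 + v * n"
  shows "coprime a n"
proof (rule coprimeI)
  fix k assume "k dvd a" "k dvd n"
  then have "k dvd a * u" "k dvd v * n" by simp_all
  then show "is_unit k" unfolding assms by (metis dvd_add_left_iff)
qed

lemma cong_power_mult:
  fixes a b x n :: nat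
  assumes "[a ^ k = b] (mod n)" "[b ^ m = x] (mod n)"
  shows "[a ^ (k * m) = x] (mod n)"
  using cong_trans[OF cong_pow[OF assms(1), of m] assms(2)] by (simp add: power_mult)

text \<open>One round of square-and-multiply, with \<open>c\<close> as the next binary digit of the
  exponent. The quotient \<open>q\<close> is supplied, so that verification is a multiplication and
  not a division.\<close>

lemma cong_power_double_step:
  fixes a x y n q :: nat
  assumes "[a ^ k = x] (mod n)" "a ^ c * (x * x) = q * n + y" "e = 2 * k + c"
  shows "[a ^ e = y] (mod n)"
proof -
  have "[a ^ c * (a ^ k * a ^ k) = a ^ c * (x * x)] (mod n)"
    by (intro cong_mult cong_refl assms(1))
  also have "[a ^ c * (x * x) = y] (mod n)"
    unfolding assms(2) by (simp add: cong_def)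
  also have "a ^ c * (a ^ k * a ^ k) = a ^ e"
    unfolding assms(3) mult_2 power_add by (simp only: mult_ac)
  finally show ?thesis .
qed

text \<open>Pocklington's criterion with base 2. The predecessor factors as
  \<open>2683454 * 3617 * 4021\<close>, and the part \<open>3617 * 4021\<close> with known prime
  factors exceeds the square root of the number.\<close>

lemma prime_39028039587479: "prime (39028039587479 :: nat)"
proof (rule pocklington_alt[where a = 2 and q = "3617 * 4021" and r = 2683454])
  note step = cong_power_double_step
  have "[2 ^ 1 = 2] (mod 39028039587479 :: nat)" by (simp only: power_one_right cong_refl)
  then have "[2 ^ 2 = 4] (mod 39028039587479 :: nat)"
    by (rule step[where c = 0 and q = 0]) simp_all
  then have "[2 ^ 5 = 32] (mod 39028039587479 :: nat)"
    by (rule step[where c = 1 and q = 0]) simp_all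
  then have "[2 ^ 10 = 1024] (mod 39028039587479 :: nat)"
    by (rule step[where c = 0 and q = 0]) simp_all
  then have "[2 ^ 20 = 1048576] (mod 39028039587479 :: nat)"
    by (rule step[where c = 0 and q = 0]) simp_all
  then have "[2 ^ 40 = 1099511627776] (mod 39028039587479 :: nat)"
    by (rule step[where c = 0 and q = 0]) simp_all
  then have "[2 ^ 81 = 23753732577353] (mod 39028039587479 :: nat)"
    by (rule step[where c = 1 and q = 61951654881]) simp_all
  then have "[2 ^ 163 = 7178013168672] (mod 39028039587479 :: nat)"
    by (rule step[where c = 1 and q = 28914586400974]) simp_all
  then have "[2 ^ 327 = 17438261801430] (mod 39028039587479 :: nat)"
    by (rule step[where c = 1 and q = 2640351582822]) simp_all
  then have "[2 ^ 655 = 1733551278397] (mod 39028039587479 :: nat)"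
    by (rule step[where c = 1 and q = 15583307686957]) simp_all
  then have "[2 ^ 1310 = 12291901430952] (mod 39028039587479 :: nat)"
    by (rule step[where c = 0 and q = 77001050183]) simp_all
  then have "[2 ^ 2620 = 23103542374800] (mod 39028039587479 :: nat)"
    by (rule step[where c = 0 and q = 3871340768976]) simp_all
  then have "[2 ^ 5241 = 7173871900094] (mod 39028039587479 :: nat)"
    by (rule step[where c = 1 and q = 27353342668814]) simp_all
  then have "[2 ^ 10482 = 976733878990] (mod 39028039587479 :: nat)"
    by (rule step[where c = 0 and q = 1318652911674]) simp_all
  then have "[2 ^ 20964 = 2530645535003] (mod 39028039587479 :: nat)"
    by (rule step[where c = 0 and q = 24444196543]) simp_all
  then have "[2 ^ 41928 = 10151110138833] (mod 39028039587479 :: nat)"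
    by (rule step[where c = 0 and q = 164091429944]) simp_all
  then have "[2 ^ 83857 = 18451564553947] (mod 39028039587479 :: nat)"
    by (rule step[where c = 1 and q = 5280564339889]) simp_all
  then have "[2 ^ 167715 = 22551755492110] (mod 39028039587479 :: nat)"
    by (rule step[where c = 1 and q = 17446955475452]) simp_all
  then have "[2 ^ 335431 = 994783277599] (mod 39028039587479 :: nat)"
    by (rule step[where c = 1 and q = 26062373675519]) simp_all
  then have "[2 ^ 670863 = 11698404103145] (mod 39028039587479 :: nat)"
    by (rule step[where c = 1 and q = 50711938383]) simp_all
  then have "[2 ^ 1341727 = 13301617997928] (mod 39028039587479 :: nat)"
    by (rule step[where c = 1 and q = 7013042930518]) simp_all
  then have r: "[2 ^ 2683454 = 25577660067061] (mod 39028039587479 :: nat)"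
    by (rule step[where c = 0 and q = 4533485238637]) simp_all
  \<comment> \<open>Raising the residue of \<open>2 ^ 2683454\<close> to 3617 gives the power of 2
    needed for the prime 4021, and raising it to 4021 gives the one for 3617. A third chain raises
    the first result to 4021 and reaches the full exponent.\<close>
  have "[25577660067061 ^ 1 = 25577660067061] (mod 39028039587479 :: nat)" by (simp only: power_one_right cong_refl)
  then have "[25577660067061 ^ 3 = 14109639365468] (mod 39028039587479 :: nat)"
    by (rule step[where c = 1 and q = 428751543739911703915349047]) simp_all
  then have "[25577660067061 ^ 7 = 19037448890328] (mod 39028039587479 :: nat)"
    by (rule step[where c = 1 and q = 130471573935452427118618184]) simp_all
  then have "[25577660067061 ^ 14 = 37205853238384] (mod 39028039587479 :: nat)"
    by (rule step[where c = 0 and q = 9286258394800]) simp_all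
  then have "[25577660067061 ^ 28 = 12604059234081] (mod 39028039587479 :: nat)"
    by (rule step[where c = 0 and q = 35468743237625]) simp_all
  then have "[25577660067061 ^ 56 = 37902268309054] (mod 39028039587479 :: nat)"
    by (rule step[where c = 0 and q = 4070466025333]) simp_all
  then have "[25577660067061 ^ 113 = 18972708714648] (mod 39028039587479 :: nat)"
    by (rule step[where c = 1 and q = 941487325117705664811620132]) simp_all
  then have "[25577660067061 ^ 226 = 35227080984628] (mod 39028039587479 :: nat)"
    by (rule step[where c = 0 and q = 9223206693844]) simp_all
  then have "[25577660067061 ^ 452 = 33613087013793] (mod 39028039587479 :: nat)"
    by (rule step[where c = 0 and q = 31796299476329]) simp_all
  then have "[25577660067061 ^ 904 = 33746441695447] (mod 39028039587479 :: nat)"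
    by (rule step[where c = 0 and q = 28949433036838]) simp_all
  then have "[25577660067061 ^ 1808 = 32443789316792] (mod 39028039587479 :: nat)"
    by (rule step[where c = 0 and q = 29179593419023]) simp_all
  then have p: "[25577660067061 ^ 3617 = 15901499388071] (mod 39028039587479 :: nat)"
    by (rule step[where c = 1 and q = 689838167457471901637326927]) simp_all
  have "[25577660067061 ^ 1 = 25577660067061] (mod 39028039587479 :: nat)" by (simp only: power_one_right cong_refl)
  then have "[25577660067061 ^ 3 = 14109639365468] (mod 39028039587479 :: nat)"
    by (rule step[where c = 1 and q = 428751543739911703915349047]) simp_all
  then have "[25577660067061 ^ 7 = 19037448890328] (mod 39028039587479 :: nat)"
    by (rule step[where c = 1 and q = 130471573935452427118618184]) simp_all
  then have "[25577660067061 ^ 15 = 5760633877179] (mod 39028039587479 :: nat)"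
    by (rule step[where c = 1 and q = 237520760517110325674309955]) simp_all
  then have "[25577660067061 ^ 31 = 16042059619123] (mod 39028039587479 :: nat)"
    by (rule step[where c = 1 and q = 21748265317555036901376982]) simp_all
  then have "[25577660067061 ^ 62 = 24028383549531] (mod 39028039587479 :: nat)"
    by (rule step[where c = 0 and q = 6593917592162]) simp_all
  then have "[25577660067061 ^ 125 = 12466194764448] (mod 39028039587479 :: nat)"
    by (rule step[where c = 1 and q = 378384367502207633800510587]) simp_all
  then have "[25577660067061 ^ 251 = 3672147585056] (mod 39028039587479 :: nat)"
    by (rule step[where c = 1 and q = 101847855718656621672656672]) simp_all
  then have "[25577660067061 ^ 502 = 36841876648899] (mod 39028039587479 :: nat)"
    by (rule step[where c = 0 and q = 345512304203]) simp_all
  then have "[25577660067061 ^ 1005 = 37525583824868] (mod 39028039587479 :: nat)"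
    by (rule step[where c = 1 and q = 889544262098128687600110767]) simp_all
  then have "[25577660067061 ^ 2010 = 37677114993435] (mod 39028039587479 :: nat)"
    by (rule step[where c = 0 and q = 36080967844691]) simp_all
  then have q: "[25577660067061 ^ 4021 = 10285064380914] (mod 39028039587479 :: nat)"
    by (rule step[where c = 1 and q = 930334991182220025113680509]) simp_all
  have "[15901499388071 ^ 1 = 15901499388071] (mod 39028039587479 :: nat)" by (simp only: power_one_right cong_refl)
  then have "[15901499388071 ^ 3 = 34662547363629] (mod 39028039587479 :: nat)"
    by (rule step[where c = 1 and q = 103023783173200198658695558]) simp_all
  then have "[15901499388071 ^ 7 = 7085717082580] (mod 39028039587479 :: nat)"
    by (rule step[where c = 1 and q = 489533359138687924061851789]) simp_all
  then have "[15901499388071 ^ 15 = 37130100805491] (mod 39028039587479 :: nat)"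
    by (rule step[where c = 1 and q = 20456388159067563006460171]) simp_all
  then have "[15901499388071 ^ 31 = 31022490037880] (mod 39028039587479 :: nat)"
    by (rule step[where c = 1 and q = 561711863811156810688717649]) simp_all
  then have "[15901499388071 ^ 62 = 15758301663050] (mod 39028039587479 :: nat)"
    by (rule step[where c = 0 and q = 24659063030650]) simp_all
  then have "[15901499388071 ^ 125 = 10656342114713] (mod 39028039587479 :: nat)"
    by (rule step[where c = 1 and q = 101176618390683123854941653]) simp_all
  then have "[15901499388071 ^ 251 = 1356007010424] (mod 39028039587479 :: nat)"
    by (rule step[where c = 1 and q = 46267672154799322001923225]) simp_all
  then have "[15901499388071 ^ 502 = 28125926428756] (mod 39028039587479 :: nat)"
    by (rule step[where c = 0 and q = 47113691380]) simp_all
  then have "[15901499388071 ^ 1005 = 2908074958865] (mod 39028039587479 :: nat)"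
    by (rule step[where c = 1 and q = 322310914828264226899668729]) simp_all
  then have "[15901499388071 ^ 2010 = 26354564175467] (mod 39028039587479 :: nat)"
    by (rule step[where c = 0 and q = 216687798202]) simp_all
  then have pq: "[15901499388071 ^ 4021 = 1] (mod 39028039587479 :: nat)"
    by (rule step[where c = 1 and q = 282991256467630364598771842]) simp_all
  have p': "[2 ^ (2683454 * 3617) = 15901499388071] (mod 39028039587479 :: nat)" by (rule cong_power_mult[OF r p])
  have q': "[2 ^ (2683454 * 4021) = 10285064380914] (mod 39028039587479 :: nat)" by (rule cong_power_mult[OF r q])
  have "[2 ^ (2683454 * 3617 * 4021) = 1] (mod 39028039587479 :: nat)" by (rule cong_power_mult[OF p' pq])
  moreover have "2683454 * 3617 * 4021 = 39028039587479 - (1 :: nat)" by simp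
  ultimately show "[2 ^ (39028039587479 - 1) = 1] (mod 39028039587479 :: nat)" by (simp only:)
  show "\<forall>p. prime p \<and> p dvd 3617 * 4021 \<longrightarrow>
    (\<exists>b. [2 ^ ((39028039587479 - 1) div p) = b] (mod 39028039587479 :: nat) \<and> coprime (b - 1) 39028039587479)"
  proof (intro allI impI)
    fix p :: nat
    assume "prime p \<and> p dvd 3617 * 4021"
    then have "p dvd 3617 \<or> p dvd 4021" "prime p" by (metis prime_dvd_mult_iff)+
    \<comment> \<open>The bound 64 suffices for both numbers because its square is 4096.\<close>
    moreover have "prime (3617 :: nat)" "prime (4021 :: nat)"
      by (rule prime_nat_sqrtI[where m = 64], simp, simp, simp)+
    ultimately have "p = 3617 \<or> p = 4021" by (metis primes_dvd_imp_eq)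
    moreover have "(39028039587479 - 1) div 3617 = 2683454 * (4021 :: nat)"
      "(39028039587479 - 1) div 4021 = 2683454 * (3617 :: nat)" by simp_all
    moreover have "coprime (15901499388071 - 1) (39028039587479 :: nat)"
      by (rule coprime_nat_bezoutI[where u = 11826010015564 and v = 4818363746001]) simp
    moreover have "coprime (10285064380914 - 1) (39028039587479 :: nat)"
      by (rule coprime_nat_bezoutI[where u = 31691650188653 and v = 8351704722372]) simp
    ultimately show "\<exists>b. [2 ^ ((39028039587479 - 1) div p) = b] (mod 39028039587479 :: nat) \<and> coprime (b - 1) 39028039587479"
      using p' q' by (elim disjE) (simp_all only:, blast+)
  qed
qed simp_all

section \<open>Compact representation of a unit\<close>

text \<open>
  An element \<open>\<theta> = x + y \<surd>d\<close> of norm \<open>N\<close> in the ideal \<open>(N, P + \<surd>d)\<close>, with logarithmic derivative \<open>y / x \<equiv> z\<close> modulo \<open>d\<close>.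
  Since \<open>\<surd>d\<close> squares to zero modulo \<open>d\<close>, \<open>z\<close> is additive under multiplication.
\<close>

definition compact_rep :: "nat \<Rightarrow> int \<Rightarrow> int \<Rightarrow> int \<Rightarrow> nat \<Rightarrow> bool" where
  "compact_rep d N P z e \<longleftrightarrow>
    (\<exists>x y :: int. x\<^sup>2 - int d * y\<^sup>2 = N \<and> N dvd x - P * y \<and> int d dvd y - z * x \<and>
       1 < of_int x + of_int y * sqrt d \<and> of_int x + of_int y * sqrt d \<le> 2 ^ e)"

text \<open>For nonnegative \<open>b\<close> the value increases with \<surd>d, so replacing
  \<surd>d by \<open>s\<close> and \<open>s + 1\<close> reduces real bounds to integer
  arithmetic.\<close>

lemma of_int_add_mult_sqrt_bounds:
  fixes a b s l u :: int
  assumes "0 \<le> s" "s\<^sup>2 \<le> int d" "int d \<le> (s + 1)\<^sup>2" "0 \<le> b"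
    and "l \<le> a + b * s" "a + b * (s + 1) \<le> u"
  shows "real_of_int l \<le> of_int a + of_int b * sqrt d" "of_int a + of_int b * sqrt d \<le> real_of_int u"
proof -
  have "real_of_int (s\<^sup>2) \<le> real_of_int (int d)" "real_of_int (int d) \<le> real_of_int ((s + 1)\<^sup>2)"
    using assms by (simp_all only: of_int_le_iff)
  then have s: "of_int s \<le> sqrt (real d)" "sqrt (real d) \<le> of_int (s + 1)"
    using assms(1) by (auto intro: real_le_rsqrt real_le_lsqrt)
  have b: "0 \<le> real_of_int b" using assms(4) by simp
  have "real_of_int l \<le> real_of_int (a + b * s)" using assms(5) by (simp only: of_int_le_iff)
  also have "\<dots> \<le> of_int a + of_int b * sqrt d"
    using mult_left_mono[OF s(1) b] by simp
  finally show "real_of_int l \<le> of_int a + of_int b * sqrt d" .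
  have "of_int a + of_int b * sqrt d \<le> real_of_int (a + b * (s + 1))"
    using mult_left_mono[OF s(2) b] by (simp only: of_int_add of_int_mult add_left_mono)
  also have "\<dots> \<le> of_int u" using assms(6) by (simp only: of_int_le_iff)
  finally show "of_int a + of_int b * sqrt d \<le> real_of_int u" .
qed

text \<open>Starts a chain from explicit coordinates; \<open>k\<close> and \<open>l\<close> are the
  cofactors witnessing the two divisibilities.\<close>

lemma compact_repI:
  fixes x y s k l :: int
  assumes "0 \<le> s" "s\<^sup>2 \<le> int d" "int d \<le> (s + 1)\<^sup>2" "0 \<le> y" "1 < x + y * s" "x + y * (s + 1) \<le> 2 ^ e"
    and "x\<^sup>2 - int d * y\<^sup>2 = N" "x - P * y = N * k" "y - z * x = int d * l"
  shows "compact_rep d N P z e"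
proof -
  have "real_of_int 2 \<le> of_int x + of_int y * sqrt d"
       "of_int x + of_int y * sqrt d \<le> real_of_int (2 ^ e)"
    using of_int_add_mult_sqrt_bounds[OF assms(1-4), of 2 x "2 ^ e"] assms(5,6) by simp_all
  then show ?thesis
    unfolding compact_rep_def using assms(7-9) by (intro exI[of _ x] exI[of _ y]) auto
qed

text \<open>
  The element \<open>\<theta>\<^sup>2\<close> lies in \<open>(N\<^sup>2, L + \<surd>d)\<close>, where \<open>L\<close> is the Hensel lift of \<open>P\<close>, and \<open>\<beta> = a + b \<surd>d\<close> is chosen in the
  conjugate ideal, so that \<open>\<theta>\<^sup>2 * \<beta> / N\<^sup>2\<close> is integral again. All divisibilities are stated with explicit
  cofactors because the simplifier multiplies large numerals much faster than it divides them.
\<close>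

lemma compact_rep_step:
  fixes N P z N' P' z' L a b s k r w i j l :: int
  assumes "compact_rep d N P z e"
    and "prime d" "0 \<le> s" "s\<^sup>2 \<le> int d" "int d \<le> (s + 1)\<^sup>2"
    and "0 \<le> b" "N\<^sup>2 \<le> a + b * s" "a + b * (s + 1) \<le> 2 ^ c * N\<^sup>2" "e' = 2 * e + c"
    and "N \<noteq> 0" "\<bar>N\<bar> < int d"
    and "L - P = N * k" "L\<^sup>2 - int d = N\<^sup>2 * r" "a + L * b = N\<^sup>2 * w"
    and "a\<^sup>2 - int d * b\<^sup>2 = N\<^sup>2 * N'" "a - P' * b = N' * j" "(L - P') * w - r * b = N' * i"
    and "a * z' - b - 2 * z * a = int d * l"
  shows "compact_rep d N' P' z' e'"
proof -
  obtain x y where xy: "x\<^sup>2 - int d * y\<^sup>2 = N" "N dvd x - P * y" "int d dvd y - z * x"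
    and theta: "1 < of_int x + of_int y * sqrt d" "of_int x + of_int y * sqrt d \<le> 2 ^ e"
    using assms(1) unfolding compact_rep_def by blast
  define D where "D = int d"
  \<comment> \<open>These are the coordinates of \<open>\<theta>\<^sup>2\<close>.\<close>
  define X Y where "X = x\<^sup>2 + D * y\<^sup>2" and "Y = 2 * x * y"
  from xy(2) obtain k' where k': "x - P * y = N * k'" by (rule dvdE)
  define t where "t = k' - k * y"
  have L: "L = P + N * k" and D: "D = L\<^sup>2 - N\<^sup>2 * r" and a: "a = N\<^sup>2 * w - L * b"
    using assms(12-14) by (simp_all add: D_def)
  have t: "x = L * y + N * t"
    using k' unfolding t_def L by (simp add: algebra_simps)
  \<comment> \<open>Rewriting \<open>x\<close> through the lift \<open>L\<close> shows
    \<open>X = L * Y + N\<^sup>2 * T\<close>, that is, \<open>\<theta>\<^sup>2\<close> lies in the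
    ideal \<open>(N\<^sup>2, L + \<surd>d)\<close>.\<close>
  define T where "T = t\<^sup>2 - r * y\<^sup>2"
  have XT: "X = L * Y + N\<^sup>2 * T"
    unfolding X_def Y_def T_def t D by (simp add: power2_eq_square algebra_simps)
  \<comment> \<open>The coordinates of \<open>\<theta>\<^sup>2 * \<beta> / N\<^sup>2\<close> with
    the division already carried out: the relations for \<open>X\<close>, \<open>D\<close> and
    \<open>a\<close> make \<open>N\<^sup>2\<close> a visible factor.\<close>
  define x' y' where "x' = T * a + Y * (L * w - r * b)" and "y' = T * b + Y * w"
  have x': "N\<^sup>2 * x' = X * a + D * Y * b"
    unfolding x'_def XT a D by (simp add: power2_eq_square algebra_simps)
  have y': "N\<^sup>2 * y' = X * b + Y * a"
    unfolding y'_def XT a by (simp add: power2_eq_square algebra_simps)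
  have XY: "X\<^sup>2 - D * Y\<^sup>2 = N\<^sup>2"
    unfolding X_def Y_def xy(1)[symmetric] D_def by (simp add: power2_eq_square algebra_simps)
  have "(N\<^sup>2 * N\<^sup>2) * (x'\<^sup>2 - D * y'\<^sup>2) = (N\<^sup>2 * x')\<^sup>2 - D * (N\<^sup>2 * y')\<^sup>2"
    by (simp add: power2_eq_square algebra_simps)
  also have "\<dots> = (X\<^sup>2 - D * Y\<^sup>2) * (a\<^sup>2 - D * b\<^sup>2)"
    unfolding x' y' by (simp add: power2_eq_square algebra_simps)
  also have "\<dots> = (N\<^sup>2 * N\<^sup>2) * N'" unfolding XY using assms(15) by (simp add: D_def)
  finally have norm: "x'\<^sup>2 - D * y'\<^sup>2 = N'" using assms(10) by simp
  have "x' - P' * y' = T * (a - P' * b) + Y * ((L - P') * w - r * b)"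
    unfolding x'_def y'_def by (simp add: algebra_simps)
  then have ideal: "N' dvd x' - P' * y'" unfolding assms(16,17) by simp
  have "N\<^sup>2 * (y' - z' * x') = N\<^sup>2 * y' - z' * (N\<^sup>2 * x')" by (simp add: algebra_simps)
  \<comment> \<open>Modulo \<open>D\<close> the first term vanishes by the residue \<open>z\<close>
    of \<open>y / x\<close>, the second by the relation expressing \<open>z'\<close> as
    \<open>2 * z + b / a\<close>. The factor \<open>N\<^sup>2\<close> then cancels because 0 <
    \<bar>N\<bar> < d.\<close>
  also have "\<dots> = 2 * x * a * (y - z * x) - x\<^sup>2 * (a * z' - b - 2 * z * a)
      + D * (y\<^sup>2 * b - z' * y\<^sup>2 * a - z' * Y * b)"
    unfolding x' y' X_def Y_def by (simp add: power2_eq_square algebra_simps)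
  also have "D dvd \<dots>"
    using xy(3) unfolding assms(18) D_def by (elim dvdE, simp only:) (intro dvd_add dvd_diff, simp_all)
  finally have "D dvd N\<^sup>2 * (y' - z' * x')" .
  moreover have "\<not> D dvd N"
    using assms(10,11) zdvd_not_zless[of "\<bar>N\<bar>" D] by (simp add: D_def)
  ultimately have deriv: "D dvd y' - z' * x'"
    using assms(2) unfolding D_def by (simp add: prime_dvd_mult_iff prime_dvd_power_iff)
  define \<theta> \<beta> where "\<theta> = of_int x + of_int y * sqrt d" and "\<beta> = of_int a + of_int b * sqrt d"
  have D_sqrt: "real_of_int D = sqrt d * sqrt d" by (simp add: D_def)
  have "of_int (N\<^sup>2) * (of_int x' + of_int y' * sqrt d) = of_int (N\<^sup>2 * x') + of_int (N\<^sup>2 * y') * sqrt d"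
    by (simp add: algebra_simps)
  also have "\<dots> = (of_int X + of_int Y * sqrt d) * \<beta>"
    unfolding x' y' \<beta>_def of_int_add of_int_mult D_sqrt by (simp only: algebra_simps)
  also have "of_int X + of_int Y * sqrt d = \<theta>\<^sup>2"
    unfolding X_def Y_def \<theta>_def of_int_add of_int_mult of_int_power of_int_numeral D_sqrt
    by (simp only: power2_eq_square algebra_simps mult_2)
  finally have main: "of_int (N\<^sup>2) * (of_int x' + of_int y' * sqrt d) = \<theta>\<^sup>2 * \<beta>" .
  \<comment> \<open>The factor \<open>\<beta> / N\<^sup>2\<close> lies between 1 and
    \<open>2 ^ c\<close>. The lower bound keeps the new element above 1, and the upper one gives the
    exponent \<open>2 * e + c\<close>.\<close>
  have \<beta>: "of_int (N\<^sup>2) \<le> \<beta>" "\<beta> \<le> 2 ^ c * of_int (N\<^sup>2)"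
    unfolding \<beta>_def
    using of_int_add_mult_sqrt_bounds[OF assms(3-5,6-8)] by simp_all
  have N2: "0 < real_of_int (N\<^sup>2)" using assms(10) by simp
  have th: "1 < \<theta>" "\<theta> \<le> 2 ^ e" using theta by (simp_all add: \<theta>_def)
  then have "1 < \<theta>\<^sup>2" by simp
  then have "1 * of_int (N\<^sup>2) < \<theta>\<^sup>2 * \<beta>"
    using \<beta>(1) N2 by (intro mult_less_le_imp_less) auto
  then have lower: "1 < of_int x' + of_int y' * sqrt d"
    unfolding main[symmetric] using N2 by simp
  have "0 \<le> \<beta>" using \<beta>(1) N2 by linarith
  then have "\<theta>\<^sup>2 * \<beta> \<le> (2 ^ e)\<^sup>2 * (2 ^ c * of_int (N\<^sup>2))"
    using th \<beta>(2) by (intro mult_mono power_mono) auto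
  also have "\<dots> = of_int (N\<^sup>2) * 2 ^ e'"
    by (simp add: assms(9) power_add power_mult[symmetric] mult_ac)
  finally have upper: "of_int x' + of_int y' * sqrt d \<le> 2 ^ e'"
    unfolding main[symmetric] using N2 by (simp only: mult_le_cancel_left_pos)
  show ?thesis
    unfolding compact_rep_def using norm ideal deriv lower upper D_def by blast
qed

section \<open>The explicit chain of seventeen squarings\<close>

text \<open>Every norm along the chain has at most seven digits, far below \<open>d\<close>. The
  last element has norm 1 and residue 0, so it is a unit whose second coordinate is divisible by
  \<open>d\<close>.\<close>

lemma compact_rep_unit_39028039587479: "compact_rep 39028039587479 1 6247242 0 6389672"
proof -
  \<comment> \<open>The constant 6247242 is the integer part of \<surd>d.\<close>
  note step = compact_rep_step[OF _ prime_39028039587479, where s = 6247242]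
  have "compact_rep 39028039587479 411101 6083387 30804055297985 44"
    by (rule compact_repI[where x = 7216758378650 and y = 1155191 and s = 6247242
          and k = 460433 and l = "- 5696043832021"])
      simp_all
  then have "compact_rep 39028039587479 224993 6125089 34048952587549 91"
    by (rule step[where L = 154195268851 and a = 356417735803 and b = 57052 and c = 3
          and k = 375064 and r = 140684104322 and w = 52055
          and j = 30975 and i = 28262 and l = "- 251679889685"])
      simp_all
  then have "compact_rep 39028039587479 (- 2166715) 4778487 5633987236557 191"
    by (rule step[where L = 37416161185 and a = 6731697469274 and b = 1077547 and c = 9
          and k = 166272 and r = 27655430954 and w = 796581
          and j = "- 730439" and i = "- 539980" and l = "- 10774002556939"])
      simp_all
  then have "compact_rep 39028039587479 1884845 4429632 38670099709066 384"
    by (rule step[where L = 3331038751177 and a = 6004912756655 and b = 961210 and c = 2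
          and k = "- 1537366" and r = 2363500998986 and w = 682017
          and j = 926923 and i = 657689 and l = 4216132122650])
      simp_all
  then have "compact_rep 39028039587479 (- 2582603) 4298993 24992826871583 772"
    by (rule step[where L = 247156615102 and a = 25818741308331 and b = 4132822 and c = 4
          and k = 131126 and r = 17194644197 and w = 287527
          and j = "- 3117695" and i = "- 216903" and l = "- 34630057882379"])
      simp_all
  then have "compact_rep 39028039587479 (- 1498787) 5249681 19730566688337 1556"
    by (rule step[where L = 4016372928282 and a = 11591219593099511 and b = 1855413726 and c = 12
          and k = "- 1555163" and r = 2418537134005 and w = 1117275227
          and j = "- 1234924915" and i = "- 743635231" and l = "- 8985677004729055"])
      simp_all
  then have "compact_rep 39028039587479 3811441 2720620 12073488184789 3116"
    by (rule step[where L = 294954540985 and a = 10484947506355 and b = 1678332 and c = 4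
          and k = "- 196792" and r = 38728469834 and w = 220375
          and j = 1552915 and i = 203907 and l = "- 7357736263333"])
      simp_all
  then have "compact_rep 39028039587479 1609801 5421836 28164112103030 6236"
    by (rule step[where L = 3397612702604 and a = 76002859855784 and b = 12165825 and c = 4
          and k = 891424 and r = 794638020377 and w = 2845364
          and j = 6237884 and i = 1458927 and l = 7822934674617])
      simp_all
  then have "compact_rep 39028039587479 (- 2300723) 4779337 24738304750772 12474"
    by (rule step[where L = 2211158853993 and a = 3388559709274 and b = 542409 and c = 2
          and k = 1373557 and r = 1886668084570 and w = 462811
          and j = "- 346067" and i = "- 295282" and l = "- 2742754425199"])
      simp_all
  then have "compact_rep 39028039587479 (- 905935) 5670558 3616625611099 24951"
    by (rule step[where L = 4474282916958 and a = 13898758869004 and b = 2224783 and c = 3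
          and k = "- 1944727" and r = 3781971184165 and w = 1880542
          and j = "- 1416214" and i = "- 1197083" and l = "- 16331767225997"])
      simp_all
  then have "compact_rep 39028039587479 (- 245767) 6242867 801490490223 49913"
    by (rule step[where L = 114270346173 and a = 656275529602139 and b = 105050432 and c = 11
          and k = "- 126129" and r = 15910103602 and w = 14627195
          and j = "- 1870285" and i = "- 260418" and l = "- 108153195119883"])
      simp_all
  then have "compact_rep 39028039587479 7429805 1630408 27133153293126 99832"
    by (rule step[where L = 20367793050 and a = 1615230949718 and b = 258551 and c = 6
          and k = "- 82849" and r = 6868165789 and w = 87212
          and j = 160662 and i = 54193 and l = 1056602506991])
      simp_all
  then have "compact_rep 39028039587479 5876525 5715348 30364842145829 199673"
    by (rule step[where L = 3601956234798 and a = 11656355836680850 and b = 1865840125 and c = 9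
          and k = 484798 and r = 235029313573 and w = 121747144
          and j = 168880454 and i = 11019547 and l = "- 7138559289171325"])
      simp_all
  then have "compact_rep 39028039587479 6957397 2253666 13222514237115 399348"
    by (rule step[where L = 6229445424223 and a = 67917811343317 and b = 10871646 and c = 2
          and k = 1060055 and r = 1123718664986 and w = 1961119
          and j = 6240373 and i = 1125691 and l = "- 82673458552463"])
      simp_all
  then have "compact_rep 39028039587479 (- 4802887) 5706550 34121864059701 798703"
    by (rule step[where L = 36868730882227 and a = 1785154127823356 and b = 285750731 and c = 7
          and k = 5299213 and r = 28081661852450 and w = 217646677
          and j = "- 32168838" and i = "- 24501917" and l = 351140740833455])
      simp_all
  then have "compact_rep 39028039587479 (- 833123) 5460709 3581876665525 1597409"
    by (rule step[where L = 16119397421306 and a = 66415547506243 and b = 10631178 and c = 3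
          and k = "- 3356188" and r = 11264005866653 and w = 7428919
          and j = "- 10036667" and i = "- 7013483" and l = "- 110037611739391"])
      simp_all
  then have "compact_rep 39028039587479 2756785 4779897 19463563942778 3194834"
    by (rule step[where L = 621420242687 and a = 14016128661286701 and b = 2243570428 and c = 16
          and k = "- 745886" and r = 556355702810 and w = 2008682153
          and j = 1194178401 and i = 1069155134 and l = 4417227456609100])
      simp_all
  then have "compact_rep 39028039587479 1 6247242 0 6389672"
    by (rule step[where L = 7580206925502 and a = 39028042344264 and b = 6247243 and c = 4
          and k = 2749653 and r = 7560601155469 and w = 6231090
          and j = 3490458 and i = 3481433 and l = "- 38927130635213"])
      simp_all
  then show ?thesis .
qed

section \<open>Descent of the divisibility to the fundamental unit\<close>

lemma compact_rep_imp_unit: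
  assumes "prime d" "compact_rep d 1 P 0 e"
  obtains X Y :: int where "of_int X + of_int Y * sqrt d \<in> ring_units (adjoin_sqrt d)" "int d dvd Y"
    "1 < of_int X + of_int Y * sqrt d" "of_int X + of_int Y * sqrt d \<le> 2 ^ e"
proof -
  obtain X Y :: int where XY: "X\<^sup>2 - int d * Y\<^sup>2 = 1" "int d dvd Y - 0 * X"
    "1 < of_int X + of_int Y * sqrt d" "of_int X + of_int Y * sqrt d \<le> 2 ^ e"
    using assms(2) unfolding compact_rep_def by blast
  have "\<bar>X\<^sup>2 - int d * Y\<^sup>2\<bar> = 1" using XY(1) by simp
  then have "of_int X + of_int Y * sqrt d \<in> ring_units (adjoin_sqrt d)"
    unfolding ring_units_adjoin_sqrt_iff[OF assms(1)] by blast
  then show ?thesis using that XY(2-4) by simp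
qed

lemma compact_rep_imp_dvd:
  assumes "prime d" "compact_rep d 1 P 0 e" "e < d"
    and "is_fundamental_unit (adjoin_sqrt d) \<epsilon>" "\<epsilon> = real x + real y * sqrt d"
  shows "d dvd y"
proof -
  let ?U = "ring_units (adjoin_sqrt d)"
  obtain X Y :: int where \<eta>: "of_int X + of_int Y * sqrt d \<in> ?U" "int d dvd Y"
    "1 < of_int X + of_int Y * sqrt d" "of_int X + of_int Y * sqrt d \<le> 2 ^ e"
    using compact_rep_imp_unit[OF assms(1,2)] by blast
  define \<eta> where "\<eta> = of_int X + of_int Y * sqrt d"
  have \<epsilon>: "\<epsilon> \<in> ?U" "1 < \<epsilon>" and gen: "\<And>u. u \<in> ?U \<Longrightarrow> \<exists>k::int. u = \<epsilon> powi k \<or> u = - (\<epsilon> powi k)"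
    using assms(4) unfolding is_fundamental_unit_def by blast+
  obtain k :: int where "\<eta> = \<epsilon> powi k \<or> \<eta> = - (\<epsilon> powi k)"
    using gen[OF \<eta>(1)] unfolding \<eta>_def by blast
  moreover have "0 < \<epsilon> powi k" using \<epsilon>(2) by simp
  ultimately have k: "\<eta> = \<epsilon> powi k" using \<eta>(3) unfolding \<eta>_def by linarith
  have "0 < k"
  proof (rule ccontr)
    assume "\<not> 0 < k"
    then have "\<epsilon> powi k \<le> \<epsilon> powi 0" using \<epsilon>(2) by (intro power_int_increasing) auto
    then show False using \<eta>(3) k unfolding \<eta>_def by simp
  qed
  define n where "n = nat k"
  have n: "\<eta> = \<epsilon> ^ n" "0 < n" using k \<open>0 < k\<close> by (simp_all add: n_def power_int_def)
  obtain a b :: int where ab: "\<epsilon> = of_int a + of_int b * sqrt d" "\<bar>a\<^sup>2 - int d * b\<^sup>2\<bar> = 1" "0 < a" "0 < b"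
    using ring_units_adjoin_sqrt_gt_1[OF assms(1) \<epsilon>] by blast
  have "of_int a + of_int b * sqrt d = of_int (int x) + of_int (int y) * sqrt d"
    using ab(1) assms(5) by simp
  then have xy: "a = int x" "b = int y" unfolding of_int_sqrt_eq_iff[OF assms(1)] by simp_all
  \<comment> \<open>Both coordinates of \<epsilon> are at least 1, so \<epsilon> is at least 2. The
    bound on \<eta> therefore limits its exponent \<open>n\<close> to at most \<open>e\<close>,
    which is below \<open>d\<close>.\<close>
  have "1 \<le> sqrt d" using prime_ge_1_nat[OF assms(1)] by simp
  then have "1 * 1 \<le> of_int b * sqrt d" using ab(4) by (intro mult_mono) auto
  moreover have "1 \<le> real_of_int a" using ab(3) by simp
  ultimately have "2 \<le> \<epsilon>" unfolding ab(1) by linarith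
  then have "2 ^ n \<le> \<epsilon> ^ n" by (intro power_mono) auto
  also have "\<dots> \<le> 2 ^ e" using \<eta>(4) n(1) by (simp add: \<eta>_def)
  finally have "n \<le> e" by simp
  then have "\<not> d dvd n" using assms(3) n(2) by (auto dest: dvd_imp_le)
  obtain X' Y' :: int where pow: "\<epsilon> ^ n = of_int X' + of_int Y' * sqrt d"
    "int d dvd a * Y' - int n * a ^ n * b"
    using power_of_int_sqrt_cong[of a b d n] unfolding ab(1) by blast
  have "Y' = Y" using pow(1) n(1) of_int_sqrt_eq_iff[OF assms(1), of X Y X' Y'] by (simp add: \<eta>_def)
  \<comment> \<open>As \<open>d\<close> divides \<open>Y\<close>, the congruence for the second
    coordinate of \<open>\<epsilon> ^ n\<close> leaves \<open>d\<close> dividing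
    \<open>n * a ^ n * b\<close>.\<close>
  then have "int d dvd a * Y - (a * Y - int n * a ^ n * b)"
    using dvd_diff[OF dvd_mult[OF \<eta>(2), of a] pow(2)] by simp
  then have "int d dvd int n * a ^ n * b" by simp
  moreover have "prime (int d)" using assms(1) by simp
  ultimately have "int d dvd int n \<or> int d dvd a \<or> int d dvd b"
    by (metis prime_dvd_mult_iff prime_dvd_power)
  \<comment> \<open>Otherwise \<open>d\<close> would divide the norm of \<epsilon>, which is 1 or
    -1.\<close>
  moreover have "\<not> int d dvd a"
  proof
    assume "int d dvd a"
    then have "int d dvd a\<^sup>2 - int d * b\<^sup>2" by (simp add: power2_eq_square)
    then have "int d dvd 1" using ab(2) by (metis dvd_abs_iff)
    then show False using \<open>prime (int d)\<close> by (metis not_prime_unit)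
  qed
  ultimately show ?thesis using \<open>\<not> d dvd n\<close> unfolding xy by simp
qed

theorem theorem1p3:
  fixes d :: nat
  assumes "d = 39028039587479"
  shows "prime d \<and> [d = 3] (mod 4) \<and>
    ring_of_integers (quadratic_field d) = adjoin_sqrt d \<and>
    (\<exists>\<epsilon> (x::nat) (y::nat).
       is_fundamental_unit (ring_of_integers (quadratic_field d)) \<epsilon> \<and>
       \<epsilon> = real x + real y * sqrt (real d)) \<and>
    (\<forall>\<epsilon> (x::nat) (y::nat).
       is_fundamental_unit (ring_of_integers (quadratic_field d)) \<epsilon> \<and>
       \<epsilon> = real x + real y * sqrt (real d) \<longrightarrow> d dvd y) \<and>
    \<not> mordell_pellian_at d"
proof -
  have prime: "prime d" unfolding assms by (rule prime_39028039587479)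
  have mod4: "[d = 3] (mod 4)" unfolding assms by (simp add: cong_def)
  note ring = ring_of_integers_quadratic_field[OF prime mod4]
  have rep: "compact_rep d 1 6247242 0 6389672"
    unfolding assms by (rule compact_rep_unit_39028039587479)
  \<comment> \<open>The unit from the chain also supplies a unit greater than 1, from which a
    fundamental unit is obtained.\<close>
  have "\<exists>\<eta>. \<eta> \<in> ring_units (adjoin_sqrt d) \<and> 1 < \<eta>"
    using compact_rep_imp_unit[OF prime rep] by blast
  then obtain \<epsilon> where \<epsilon>: "is_fundamental_unit (adjoin_sqrt d) \<epsilon>"
    using fundamental_unit_exists[OF prime] by blast
  then have "\<epsilon> \<in> ring_units (adjoin_sqrt d)" "1 < \<epsilon>" unfolding is_fundamental_unit_def by blast+
  then obtain a b :: int where ab: "\<epsilon> = of_int a + of_int b * sqrt d" "0 < a" "0 < b"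
    using ring_units_adjoin_sqrt_gt_1[OF prime] by blast
  then have "\<epsilon> = real (nat a) + real (nat b) * sqrt d" by simp
  with \<epsilon> have exists: "\<exists>\<epsilon> (x::nat) (y::nat). is_fundamental_unit (adjoin_sqrt d) \<epsilon> \<and>
      \<epsilon> = real x + real y * sqrt (real d)" by blast
  have bound: "6389672 < d" unfolding assms by simp
  have dvd: "\<forall>\<epsilon> (x::nat) (y::nat). is_fundamental_unit (adjoin_sqrt d) \<epsilon> \<and>
      \<epsilon> = real x + real y * sqrt (real d) \<longrightarrow> d dvd y"
    using compact_rep_imp_dvd[OF prime rep bound] by blast
  \<comment> \<open>The conjecture quantifies universally over fundamental units, so its failure
    needs \<open>exists\<close> as well as \<open>dvd\<close>.\<close>
  have "\<not> mordell_pellian_at d"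
    unfolding mordell_pellian_at_def ring using prime mod4 exists dvd by blast
  then show ?thesis unfolding ring using prime mod4 exists dvd by blast
qed

end
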